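(* Let $q$ be a prime power and let $1\leq m\leq n/2$. The sets $$T_q(n,m)\times\prod_{X\in B_q(n)_{m-1}}\mathcal{DU}(X)\qquad\text{and}\qquad T_q(n,m-1)\times\prod_{X\in B_q(n)_m}\mathcal{UD}(X)$$ have the same cardinality.
   Context: $B_q(n)_k$ is the set of $k$-dimensional subspaces of $\mathbb{F}_q^n$. For $0\leq m\leq n/2$, the Grassmann graph $C_q(n,m)$ has vertex set $B_q(n)_m$, with $X,Y$ adjacent iff $\dim(X\cap Y)=m-1$. A rooted spanning tree of a graph is a spanning tree together with a choice of a vertex as root; $T_q(n,m)$ is the set of rooted spanning trees of $C_q(n,m)$. For $1\leq k\leq n$, $X\in B_q(n)_k$ and $X'\in B_q(n)_{k-1}$: $\mathcal{UD}(X)=\{(Y,Z)\in B_q(n)_{k-1}\times B_q(n)_k : X\supseteq Y\subseteq Z\}$ and $\mathcal{DU}(X')=\{(Y',Z')\in B_q(n)_k\times B_q(n)_{k-1}: X'\subseteq Y'\supseteq Z'\}$. The products are Cartesian products. *)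

theory Defs
  imports
    "HOL-Analysis.Cartesian_Space"
    "HOL-Library.FuncSet"
    "HOL-Library.Equipollence"
begin

text \<open>
  A finite undirected simple graph is given by its vertex set \<open>V\<close> and a set \<open>E\<close> of two-element
  subsets of \<open>V\<close>.
\<close>

definition connected_graph :: "'v set \<Rightarrow> 'v set set \<Rightarrow> bool" where
  "connected_graph V E \<longleftrightarrow> (\<forall>u\<in>V. \<forall>v\<in>V. (u, v) \<in> {(x, y). {x, y} \<in> E}\<^sup>*)"

definition is_cycle :: "'v set set \<Rightarrow> 'v list \<Rightarrow> bool" where
  "is_cycle E c \<longleftrightarrow> length c \<ge> 3 \<and> distinct c \<and>
     (\<forall>i < length c. {c ! i, c ! (Suc i mod length c)} \<in> E)"

definition is_tree :: "'v set \<Rightarrow> 'v set set \<Rightarrow> bool" where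
  "is_tree V E \<longleftrightarrow> V \<noteq> {} \<and> connected_graph V E \<and> (\<nexists>c. is_cycle E c)"

text \<open>A spanning tree of \<open>(V, E)\<close> has vertex set \<open>V\<close>, so it is represented by its edge set alone.\<close>

definition spanning_trees :: "'v set \<Rightarrow> 'v set set \<Rightarrow> 'v set set set" where
  "spanning_trees V E = {F. F \<subseteq> E \<and> is_tree V F}"

definition rooted_spanning_trees :: "'v set \<Rightarrow> 'v set set \<Rightarrow> ('v set set \<times> 'v) set" where
  "rooted_spanning_trees V E = spanning_trees V E \<times> V"

text \<open>
  Below, \<open>'a\<close> ranges over the finite fields, with \<open>q = CARD('a)\<close>, and \<open>n = CARD('n)\<close>.
\<close>

definition Bq :: "nat \<Rightarrow> ('a::{field,finite} ^ 'n::finite) set set" where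
  "Bq k = {X. vec.subspace X \<and> vec.dim X = k}"

text \<open>
  The condition \<open>dim (X \<inter> Y) = m - 1\<close> is stated without truncated subtraction, so that for
  \<open>m = 0\<close> there is no edge (in particular no loop) at the zero subspace.
\<close>

definition grassmann_edges :: "nat \<Rightarrow> ('a::{field,finite} ^ 'n::finite) set set set" where
  "grassmann_edges m = {{X, Y} | X Y. X \<in> Bq m \<and> Y \<in> Bq m \<and> vec.dim (X \<inter> Y) + 1 = m}"

definition Tq ::
  "nat \<Rightarrow> (('a::{field,finite} ^ 'n::finite) set set set \<times> ('a ^ 'n) set) set" where
  "Tq m = rooted_spanning_trees (Bq m) (grassmann_edges m)"

text \<open>
  In the next two definitions \<open>1 \<le> k\<close> is intended, with \<open>X\<close> of dimension \<open>k\<close> in \<open>UD k X\<close>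
  and of dimension \<open>k - 1\<close> in \<open>DU k X\<close>.
\<close>

definition UD :: "nat \<Rightarrow> ('a::{field,finite} ^ 'n::finite) set
    \<Rightarrow> (('a ^ 'n) set \<times> ('a ^ 'n) set) set" where
  "UD k X = {(Y, Z). Y \<in> Bq (k - 1) \<and> Z \<in> Bq k \<and> Y \<subseteq> X \<and> Y \<subseteq> Z}"

definition DU :: "nat \<Rightarrow> ('a::{field,finite} ^ 'n::finite) set
    \<Rightarrow> (('a ^ 'n) set \<times> ('a ^ 'n) set) set" where
  "DU k X = {(Y, Z). Y \<in> Bq k \<and> Z \<in> Bq (k - 1) \<and> X \<subseteq> Y \<and> Z \<subseteq> Y}"

end

theory Submission
  imports Defs "HOL-Analysis.Determinants" "HOL-Computational_Algebra.Polynomial"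
    "HOL-Library.Transitive_Closure_Table"
begin

text \<open>
  Call the subspaces of dimension \<open>m\<close> points and those of dimension \<open>m - 1\<close> lines. Every point is
  on the same number \<open>r\<close> of lines, every line has the same number \<open>s\<close> of points, and two points
  have at most one common line, having one iff they are adjacent in the Grassmann graph; dually
  for lines. Hence, if \<open>N\<close> is the incidence matrix, \<open>r s - N N\<^sup>T\<close>, restricted to the points, and
  \<open>r s - N\<^sup>T N\<close>, restricted to the lines, are the Laplacians of the two graphs. By the matrix
  forest theorem \<open>det (t + r s - N N\<^sup>T)\<close> enumerates the rooted spanning forests of the graph on
  the points by their number of roots, and likewise for the lines. Up to a power of \<open>t + r s\<close> the
  two determinants agree, and comparing the coefficients of \<open>t\<close> yields \<open>T (r s)^l = T' (r s)^p\<close>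
  for the numbers \<open>T\<close>, \<open>T'\<close> of rooted spanning trees and \<open>p\<close>, \<open>l\<close> of points and lines. Finally
  \<open>UD X\<close> and \<open>DU X\<close> are the sets of walks of length two from \<open>X\<close> in the incidence graph, of which
  there are \<open>r s\<close>.
\<close>

section \<open>Determinants over commutative rings\<close>

lemma det_replace_row_by_combination:
  fixes A :: "'a::comm_ring_1 ^ 'n ^ 'n"
  shows "det (\<chi> i. if i = k then \<Sum>j\<in>UNIV. c j *s row j A else row i A) = c k * det A"
proof -
  have replace_row: "det (\<chi> i. if i = k then row j A else row i A) = (if j = k then det A else 0)"
    for j
  proof (cases "j = k")
    case True
    then have "(\<chi> i. if i = k then row j A else row i A) = A"
      by (simp add: row_def vec_eq_iff)
    with True show ?thesis by simp
  next
    case False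
    then show ?thesis by (simp add: det_identical_rows[of j k] row_def vec_eq_iff)
  qed
  show ?thesis
    by (simp add: det_linear_row_sum det_row_mul replace_row if_distrib[of "(*) _"] cong: if_cong)
qed

lemma kernel_entry_times_det:
  fixes A :: "'a::comm_ring_1 ^ 'n ^ 'n"
  assumes "A *v x = 0"
  shows "x $ k * det A = 0"
proof -
  have "x $ k * det A = det (\<chi> i. if i = k then A *v x else row i (transpose A))"
    using det_replace_row_by_combination[of k "\<lambda>j. x $ j" "transpose A"]
    by (simp add: matrix_mult_sum cong: if_cong)
  then show ?thesis using assms by (simp add: det_row_0 cong: if_cong)
qed

lemma mat_matrix_mult_commute:
  fixes A :: "'a::comm_semiring_1 ^ 'n ^ 'm"
  shows "A ** mat x = mat x ** A"
  by (simp add: vec_eq_iff matrix_matrix_mult_def mat_def if_distribR if_distrib mult.commute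
      cong: if_cong)

lemma matrix_diff_ldistrib:
  fixes A :: "'a::ring_1 ^ 'n ^ 'm"
  shows "A ** (B - C) = A ** B - A ** C"
  by (simp add: vec_eq_iff matrix_matrix_mult_def algebra_simps sum_subtractf)

lemma matrix_diff_rdistrib:
  fixes A :: "'a::ring_1 ^ 'n ^ 'm"
  shows "(A - B) ** C = A ** C - B ** C"
  by (simp add: vec_eq_iff matrix_matrix_mult_def algebra_simps sum_subtractf)

lemma det_diff_mult_commute_nonsingular:
  fixes A B :: "'a::idom ^ 'n ^ 'n"
  assumes "det A \<noteq> 0"
  shows "det (mat x - A ** B) = det (mat x - B ** A)"
proof -
  have "(mat x - A ** B) ** A = A ** (mat x - B ** A)"
    by (simp only: matrix_diff_ldistrib matrix_diff_rdistrib mat_matrix_mult_commute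
        matrix_mul_assoc)
  then have "det (mat x - A ** B) * det A = det A * det (mat x - B ** A)"
    by (metis det_mul)
  with assms show ?thesis by simp
qed

lemma poly_det: "poly (det A) z = det (map_matrix (\<lambda>p. poly p z) A)"
  by (simp add: det_def poly_sum poly_prod)

text \<open>The determinant along the segment from the identity matrix to \<open>A\<close> is a nonzero polynomial in
  the parameter, so that the nonsingular case applies over the polynomial ring.\<close>

lemma det_diff_mult_commute:
  fixes A B :: "'a::idom ^ 'n ^ 'n"
  shows "det (mat x - A ** B) = det (mat x - B ** A)"
proof -
  define segment :: "'a poly ^ 'n ^ 'n"
    where "segment = (\<chi> i j. [:mat 1 $ i $ j, (A - mat 1) $ i $ j:])"
  define const_B :: "'a poly ^ 'n ^ 'n"
    where "const_B = (\<chi> i j. [:B $ i $ j:])"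
  have poly_segment: "poly (segment $ i $ j) 0 = mat 1 $ i $ j"
    "poly (segment $ i $ j) 1 = A $ i $ j" for i j
    by (simp_all add: segment_def)
  have segment_at_0: "map_matrix (\<lambda>p. poly p 0) segment = mat 1"
    by (simp add: poly_segment vec_eq_iff)
  have differences_at_1:
    "map_matrix (\<lambda>p. poly p 1) (mat [:x:] - segment ** const_B) = mat x - A ** B"
    "map_matrix (\<lambda>p. poly p 1) (mat [:x:] - const_B ** segment) = mat x - B ** A"
    by (simp_all add: poly_segment const_B_def mat_def vec_eq_iff matrix_matrix_mult_def poly_sum
        mult.commute)
  have "poly (det segment) 0 \<noteq> 0" by (simp add: poly_det segment_at_0)
  then have "det segment \<noteq> 0" by auto
  then have "det (mat [:x:] - segment ** const_B) = det (mat [:x:] - const_B ** segment)"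
    by (rule det_diff_mult_commute_nonsingular)
  from arg_cong[OF this, of "\<lambda>p. poly p 1"] show ?thesis
    by (simp add: poly_det differences_at_1)
qed

section \<open>Forest maps\<close>

text \<open>A rooted forest is encoded by its parent function, whose fixed points are the roots.\<close>

inductive reaches_root :: "('v \<Rightarrow> 'v) \<Rightarrow> 'v \<Rightarrow> bool" for f :: "'v \<Rightarrow> 'v" where
  root: "f i = i \<Longrightarrow> reaches_root f i"
| step: "reaches_root f (f i) \<Longrightarrow> reaches_root f i"

definition forest_map :: "('v \<Rightarrow> 'v) \<Rightarrow> bool" where
  "forest_map f \<longleftrightarrow> (\<forall>i. reaches_root f i)"

lemma reaches_root_image_iff: "reaches_root f (f i) \<longleftrightarrow> reaches_root f i"
  by (metis reaches_root.cases reaches_root.step)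

lemma reaches_root_fun_upd_self:
  assumes "reaches_root f j"
  shows "reaches_root (f(i := i)) j"
  using assms
proof (induction rule: reaches_root.induct)
  case (root j)
  then show ?case by (intro reaches_root.root) auto
next
  case (step j)
  then show ?case by (cases "j = i") (auto intro: reaches_root.intros)
qed

lemma forest_map_fun_upd_self:
  assumes "forest_map f"
  shows "forest_map (f(i := i))"
  using assms by (simp add: forest_map_def reaches_root_fun_upd_self)

lemma forest_map_child_of_root:
  assumes "forest_map f" and "f i \<noteq> i"
  obtains j where "f j \<noteq> j" and "f (f j) = f j"
proof -
  have "reaches_root f i" using assms(1) by (simp add: forest_map_def)
  from this assms(2) have "\<exists>j. f j \<noteq> j \<and> f (f j) = f j"
    by (induction rule: reaches_root.induct) auto
  with that show thesis by blast
qed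

section \<open>The matrix forest theorem\<close>

definition arc_vector :: "'v \<Rightarrow> 'v \<Rightarrow> 'a::comm_ring_1 ^ 'v::finite" where
  "arc_vector i j = (if i = j then axis i 1 else axis i 1 - axis j 1)"

definition parent_matrix :: "('v \<Rightarrow> 'v) \<Rightarrow> 'a::comm_ring_1 ^ 'v ^ 'v::finite" where
  "parent_matrix f = (\<chi> i. arc_vector i (f i))"

lemma det_parent_matrix_fun_upd_self:
  assumes "f i \<noteq> i" and "f (f i) = f i"
  shows "det (parent_matrix (f(i := i)) :: 'a::comm_ring_1 ^ 'v ^ 'v::finite)
    = det (parent_matrix f :: 'a ^ 'v ^ 'v)"
proof -
  have "parent_matrix (f(i := i)) = (\<chi> k. if k = i then row i (parent_matrix f)
      + 1 *s row (f i) (parent_matrix f) else row k (parent_matrix f) :: 'a ^ 'v ^ 'v)"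
    using assms by (simp add: parent_matrix_def arc_vector_def row_def vec_eq_iff)
  then show ?thesis using det_row_operation[of i "f i" "parent_matrix f" 1] assms(1) by simp
qed

lemma det_parent_matrix_forest_map:
  assumes "forest_map f"
  shows "det (parent_matrix f :: 'a::comm_ring_1 ^ 'v ^ 'v::finite) = 1"
  using assms
proof (induction "card {i. f i \<noteq> i}" arbitrary: f rule: less_induct)
  case less
  show ?case
  proof (cases "\<exists>i. f i \<noteq> i")
    case False
    then have "parent_matrix f = (mat 1 :: 'a ^ 'v ^ 'v)"
      by (auto simp: parent_matrix_def arc_vector_def mat_def vec_eq_iff axis_def)
    then show ?thesis by simp
  next
    case True
    then obtain j where "f j \<noteq> j" by blast
    with less.prems obtain i where parent_is_root: "f i \<noteq> i" "f (f i) = f i"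
      by (rule forest_map_child_of_root)
    have "{j. (f(i := i)) j \<noteq> j} = {j. f j \<noteq> j} - {i}" by auto
    then have "card {j. (f(i := i)) j \<noteq> j} < card {j. f j \<noteq> j}"
      using parent_is_root(1) card_Diff1_less[of "{j. f j \<noteq> j}" i] by simp
    then have "det (parent_matrix (f(i := i)) :: 'a ^ 'v ^ 'v) = 1"
      using less.hyps forest_map_fun_upd_self[OF less.prems] by blast
    then show ?thesis by (simp add: det_parent_matrix_fun_upd_self[OF parent_is_root])
  qed
qed

lemma parent_matrix_mult_vec:
  "(parent_matrix f *v x) $ i = (if f i = i then x $ i else x $ i - x $ f i)"
  by (simp add: matrix_vector_mult_def parent_matrix_def arc_vector_def axis_def left_diff_distrib
      sum_subtractf if_distrib[of "\<lambda>a. a * _"] cong: if_cong)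

text \<open>The indicator of the points that never reach a root lies in the kernel.\<close>

lemma det_parent_matrix_not_forest_map:
  assumes "\<not> forest_map f"
  shows "det (parent_matrix f :: 'a::comm_ring_1 ^ 'v ^ 'v::finite) = 0"
proof -
  let ?x = "\<chi> j. of_bool (\<not> reaches_root f j) :: 'a ^ 'v"
  obtain k where "\<not> reaches_root f k" using assms by (auto simp: forest_map_def)
  then have "?x $ k = 1" by simp
  moreover have "parent_matrix f *v ?x = 0"
    by (auto simp: vec_eq_iff parent_matrix_mult_vec reaches_root_image_iff reaches_root.root)
  ultimately show ?thesis
    using kernel_entry_times_det[of "parent_matrix f" ?x k] by simp
qed

definition diagonal_matrix :: "('v \<Rightarrow> 'a::comm_ring_1) \<Rightarrow> 'a ^ 'v ^ 'v::finite" where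
  "diagonal_matrix s = (\<chi> i j. if i = j then s i else 0)"

definition laplacian_matrix :: "('v \<Rightarrow> 'v \<Rightarrow> 'a::comm_ring_1) \<Rightarrow> 'a ^ 'v ^ 'v::finite" where
  "laplacian_matrix w = (\<chi> i j. if i = j then \<Sum>k\<in>UNIV - {i}. w i k else - w i j)"

lemma diagonal_plus_laplacian_eq_sum_arc_vector:
  "diagonal_matrix s + laplacian_matrix w
    = (\<chi> i. \<Sum>k\<in>UNIV. (if k = i then s i else w i k) *s arc_vector i k)"
proof -
  have "(\<Sum>k\<in>UNIV. (if k = i then s i else w i k) *s arc_vector i k) $ j
      = (diagonal_matrix s + laplacian_matrix w) $ i $ j" for i j
  proof -
    have "(\<Sum>k\<in>UNIV. (if k = i then s i else w i k) *s arc_vector i k) $ j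
        = (if i = j then s i else 0) + (\<Sum>k\<in>UNIV - {i}. w i k * arc_vector i k $ j)"
      by (simp add: sum.remove[of _ i] arc_vector_def axis_def)
    also have "(\<Sum>k\<in>UNIV - {i}. w i k * arc_vector i k $ j)
        = (\<Sum>k\<in>UNIV - {i}. (if i = j then w i k else 0) - (if k = j then w i k else 0))"
      by (rule sum.cong) (auto simp: arc_vector_def axis_def)
    also have "\<dots> = (if i = j then \<Sum>k\<in>UNIV - {i}. w i k else - w i j)"
      by (simp add: sum_subtractf)
    finally show ?thesis by (simp add: diagonal_matrix_def laplacian_matrix_def)
  qed
  then show ?thesis by (simp add: vec_eq_iff)
qed

theorem weighted_matrix_forest:
  "det (diagonal_matrix s + laplacian_matrix w)
    = (\<Sum>f | forest_map f. \<Prod>i\<in>UNIV. if f i = i then s i else w i (f i))"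
proof -
  let ?c = "\<lambda>i k. if k = i then s i else w i k"
  have "det (diagonal_matrix s + laplacian_matrix w)
      = (\<Sum>f\<in>UNIV. det (\<chi> i. ?c i (f i) *s arc_vector i (f i)))"
    by (simp add: diagonal_plus_laplacian_eq_sum_arc_vector det_linear_rows_sum)
  also have "\<dots> = (\<Sum>f\<in>UNIV. (\<Prod>i\<in>UNIV. ?c i (f i)) * det (parent_matrix f))"
    by (simp add: det_rows_mul parent_matrix_def)
  also have "\<dots> = (\<Sum>f\<in>UNIV. if forest_map f then \<Prod>i\<in>UNIV. ?c i (f i) else 0)"
    by (rule sum.cong) (auto simp: det_parent_matrix_forest_map det_parent_matrix_not_forest_map)
  also have "\<dots> = (\<Sum>f | forest_map f. \<Prod>i\<in>UNIV. ?c i (f i))"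
    by (simp add: sum.If_cases)
  finally show ?thesis .
qed

section \<open>Rooted spanning trees as forest maps with one root\<close>

definition simple_graph :: "'v set \<Rightarrow> 'v set set \<Rightarrow> bool" where
  "simple_graph V E \<longleftrightarrow> (\<forall>e\<in>E. \<exists>u\<in>V. \<exists>v\<in>V. u \<noteq> v \<and> e = {u, v})"

lemma simple_graph_edgeD:
  assumes "simple_graph V E" and "{u, v} \<in> E"
  shows "u \<in> V" and "v \<in> V" and "u \<noteq> v"
  using assms by (auto simp: simple_graph_def doubleton_eq_iff)

lemma is_cycle_two_neighbours:
  assumes "is_cycle E c" and "v \<in> set c"
  obtains u w where "u \<in> set c" and "w \<in> set c" and "u \<noteq> w" and "{v, u} \<in> E" and "{v, w} \<in> E"
proof -
  let ?n = "length c"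
  have length_ge_3: "?n \<ge> 3" and "distinct c"
    and edge: "\<And>i. i < ?n \<Longrightarrow> {c ! i, c ! (Suc i mod ?n)} \<in> E"
    using assms(1) by (auto simp: is_cycle_def)
  obtain i where i: "i < ?n" "c ! i = v" using assms(2) by (auto simp: in_set_conv_nth)
  define succ where "succ = (if Suc i = ?n then 0 else Suc i)"
  define pred where "pred = (if i = 0 then ?n - 1 else i - 1)"
  have "Suc i mod ?n = succ" "Suc pred mod ?n = i"
    using i(1) by (auto simp: succ_def pred_def)
  moreover have "succ < ?n" "pred < ?n" "succ \<noteq> pred"
    using length_ge_3 i(1) by (auto simp: succ_def pred_def split: if_splits)
  ultimately show thesis
    using that[of "c ! succ" "c ! pred"] edge[of i] edge[of pred] i \<open>distinct c\<close>
    by (simp add: nth_eq_iff_index_eq insert_commute)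
qed

lemma is_cycle_if_connected_without_edge:
  assumes "(u, v) \<in> {(x, y). {x, y} \<in> F}\<^sup>*" and "F \<subseteq> E" and "{u, v} \<in> E - F" and "u \<noteq> v"
  shows "\<exists>c. is_cycle E c"
proof -
  have "(\<lambda>x y. {x, y} \<in> F)\<^sup>*\<^sup>* u v"
    using assms(1) by (simp flip: rtranclp_rtrancl_eq)
  then obtain xs where path: "rtrancl_path (\<lambda>x y. {x, y} \<in> F) u xs v" and "distinct (u # xs)"
    by (auto simp: rtranclp_eq_rtrancl_path elim: rtrancl_path_distinct)
  have "xs \<noteq> []" using path assms(4) by (auto elim: rtrancl_path.cases)
  with path have "last xs = v" by (rule rtrancl_path_last)
  have step: "{(u # xs) ! i, xs ! i} \<in> F" if "i < length xs" for i
    using rtrancl_path_nth[OF path that] .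
  have "length xs \<noteq> 1"
    using step[of 0] assms(3) \<open>last xs = v\<close> by (auto simp: length_Suc_conv)
  with \<open>xs \<noteq> []\<close> have "length (u # xs) \<ge> 3"
    by (cases xs) (auto simp: Suc_le_eq)
  moreover have "{(u # xs) ! i, (u # xs) ! (Suc i mod length (u # xs))} \<in> E"
    if "i < length (u # xs)" for i
  proof (cases "i = length xs")
    case True
    with \<open>xs \<noteq> []\<close> \<open>last xs = v\<close> have "(u # xs) ! i = v" by (simp add: last_conv_nth nth_Cons')
    with True assms(3) show ?thesis by (simp add: insert_commute)
  next
    case False
    with that step[of i] assms(2) show ?thesis by auto
  qed
  ultimately have "is_cycle E (u # xs)"
    using \<open>distinct (u # xs)\<close> by (simp add: is_cycle_def)
  then show ?thesis by blast
qed

lemma acyclic_eq_connected_subgraph: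
  assumes "simple_graph V E" and "\<nexists>c. is_cycle E c" and "F \<subseteq> E" and "connected_graph V F"
  shows "F = E"
proof (rule ccontr)
  assume "F \<noteq> E"
  with \<open>F \<subseteq> E\<close> obtain e where missing: "e \<in> E - F" by blast
  with assms(1) obtain u v where ends: "e = {u, v}" "u \<in> V" "v \<in> V" "u \<noteq> v"
    by (auto simp: simple_graph_def)
  then have "(u, v) \<in> {(x, y). {x, y} \<in> F}\<^sup>*"
    using assms(4) by (simp add: connected_graph_def)
  then have "\<exists>c. is_cycle E c"
    by (rule is_cycle_if_connected_without_edge) (use missing ends \<open>F \<subseteq> E\<close> in auto)
  with assms(2) show False ..
qed

definition parent_edges :: "('v \<Rightarrow> 'v) \<Rightarrow> 'v set set" where
  "parent_edges f = {{i, f i} | i. f i \<noteq> i}"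

lemma parent_edges_iff:
  "{u, v} \<in> parent_edges f \<longleftrightarrow> u \<noteq> v \<and> (f u = v \<or> f v = u)"
  by (auto simp: parent_edges_def doubleton_eq_iff)

lemma parent_edges_subset_iff: "parent_edges f \<subseteq> E \<longleftrightarrow> (\<forall>i. f i \<noteq> i \<longrightarrow> {i, f i} \<in> E)"
  by (auto simp: parent_edges_def)

definition root_distance :: "('v \<Rightarrow> 'v) \<Rightarrow> 'v \<Rightarrow> nat" where
  "root_distance f i = (LEAST k. f ((f ^^ k) i) = (f ^^ k) i)"

lemma reaches_root_funpow:
  assumes "reaches_root f i"
  shows "\<exists>k. f ((f ^^ k) i) = (f ^^ k) i"
  using assms
proof (induction rule: reaches_root.induct)
  case (root i)
  then show ?case by (intro exI[of _ 0]) simp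
next
  case (step i)
  then obtain k where "f ((f ^^ k) (f i)) = (f ^^ k) (f i)" by blast
  then show ?case by (intro exI[of _ "Suc k"]) (simp add: funpow_swap1)
qed

lemma root_distance_Suc:
  assumes "forest_map f" and "f i \<noteq> i"
  shows "root_distance f i = Suc (root_distance f (f i))"
proof -
  obtain k where "f ((f ^^ k) i) = (f ^^ k) i"
    using assms(1) reaches_root_funpow by (metis forest_map_def)
  from Least_Suc[of "\<lambda>k. f ((f ^^ k) i) = (f ^^ k) i", OF this] assms(2)
  show ?thesis by (simp add: root_distance_def funpow_swap1)
qed

lemma forest_map_no_two_cycle:
  assumes "forest_map f" and "f (f i) = i"
  shows "f i = i"
  using root_distance_Suc[OF assms(1), of i] root_distance_Suc[OF assms(1), of "f i"] assms(2)
  by force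

text \<open>Both cycle neighbours of a vertex farthest from the root would have to be its parent.\<close>

lemma not_is_cycle_parent_edges:
  assumes "forest_map f"
  shows "\<not> is_cycle (parent_edges f) c"
proof
  assume cycle: "is_cycle (parent_edges f) c"
  then have "set c \<noteq> {}" by (auto simp: is_cycle_def)
  then obtain v where v_in_c: "v \<in> set c" "Max (root_distance f ` set c) = root_distance f v"
    by (rule obtains_MAX[OF List.finite_set])
  then have farthest: "root_distance f u \<le> root_distance f v" if "u \<in> set c" for u
    using that by (metis Max_ge List.finite_set finite_imageI imageI)
  have parent: "u = f v" if "u \<in> set c" "{v, u} \<in> parent_edges f" for u
  proof (rule ccontr)
    assume "u \<noteq> f v"
    with that(2) have "f u = v" "f u \<noteq> u" by (auto simp: parent_edges_iff)
    then have "root_distance f u = Suc (root_distance f v)"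
      using root_distance_Suc[OF assms, of u] by simp
    with farthest[OF that(1)] show False by simp
  qed
  obtain u w where "u \<in> set c" "w \<in> set c" "u \<noteq> w"
      "{v, u} \<in> parent_edges f" "{v, w} \<in> parent_edges f"
    using is_cycle_two_neighbours[OF cycle v_in_c(1)] .
  then show False using parent by blast
qed

lemma forest_map_if_descending:
  fixes d :: "'v \<Rightarrow> nat"
  assumes "\<And>i. f i \<noteq> i \<Longrightarrow> d (f i) < d i"
  shows "forest_map f"
proof -
  have "reaches_root f i" for i
    by (induction "d i" arbitrary: i rule: less_induct) (metis assms reaches_root.intros)
  then show ?thesis by (simp add: forest_map_def)
qed

definition forest_maps :: "'v set set \<Rightarrow> ('v \<Rightarrow> 'v) set" where
  "forest_maps E = {f. forest_map f \<and> parent_edges f \<subseteq> E}"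

text \<open>The points outside \<open>V\<close> are fixed by a forest map of \<open>(V, E)\<close>, but are not among its roots.\<close>

definition roots :: "'v set \<Rightarrow> ('v \<Rightarrow> 'v) \<Rightarrow> 'v set" where
  "roots V f = {i \<in> V. f i = i}"

lemma forest_maps_parent_in:
  assumes "simple_graph V E" and "f \<in> forest_maps E" and "f i \<noteq> i"
  shows "i \<in> V" and "f i \<in> V" and "{i, f i} \<in> E"
proof -
  show "{i, f i} \<in> E" using assms(2,3) by (auto simp: forest_maps_def parent_edges_subset_iff)
  then show "i \<in> V" and "f i \<in> V" using simple_graph_edgeD[OF assms(1)] by blast+
qed

lemma forest_maps_connected_to_root:
  assumes "simple_graph V E" and forest: "f \<in> forest_maps E" and "i \<in> V"
  shows "\<exists>r\<in>roots V f. (i, r) \<in> {(x, y). {x, y} \<in> parent_edges f}\<^sup>*"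
proof -
  have "reaches_root f i" using forest by (simp add: forest_maps_def forest_map_def)
  then show ?thesis using \<open>i \<in> V\<close>
  proof (induction rule: reaches_root.induct)
    case (root i)
    then show ?case by (auto simp: roots_def)
  next
    case (step i)
    show ?case
    proof (cases "f i = i")
      case False
      then have "(i, f i) \<in> {(x, y). {x, y} \<in> parent_edges f}" by (simp add: parent_edges_iff)
      moreover have "f i \<in> V" using forest_maps_parent_in[OF assms(1) forest False] by simp
      ultimately show ?thesis using step.IH by (meson converse_rtrancl_into_rtrancl)
    qed (use step in simp)
  qed
qed

definition arborescences :: "'v set \<Rightarrow> 'v set set \<Rightarrow> (('v \<Rightarrow> 'v) \<times> 'v) set" where
  "arborescences V E = {(f, r). f \<in> forest_maps E \<and> roots V f = {r}}"

lemma is_tree_arborescence: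
  assumes "simple_graph V E" and "(f, r) \<in> arborescences V E"
  shows "is_tree V (parent_edges f)"
proof -
  let ?R = "{(x, y). {x, y} \<in> parent_edges f}"
  have forest: "f \<in> forest_maps E" and single_root: "roots V f = {r}"
    using assms(2) by (auto simp: arborescences_def)
  have to_root: "(u, r) \<in> ?R\<^sup>*" if "u \<in> V" for u
    using forest_maps_connected_to_root[OF assms(1) forest that] single_root by simp
  have "sym (?R\<^sup>*)" by (intro sym_rtrancl) (auto simp: sym_def insert_commute)
  then have "connected_graph V (parent_edges f)"
    unfolding connected_graph_def using to_root by (meson rtrancl_trans symD)
  moreover have "V \<noteq> {}" using single_root by (auto simp: roots_def)
  ultimately show ?thesis
    using forest not_is_cycle_parent_edges by (auto simp: is_tree_def forest_maps_def)
qed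

lemma arborescence_unique:
  assumes "simple_graph V E"
    and "(f, r) \<in> arborescences V E" and "(g, r) \<in> arborescences V E"
    and edges: "parent_edges f = parent_edges g"
  shows "f = g"
proof
  fix v
  have forest: "f \<in> forest_maps E" "g \<in> forest_maps E" and roots: "roots V f = roots V g"
    using assms(2,3) by (simp_all add: arborescences_def)
  have fixed_iff: "f i = i \<longleftrightarrow> g i = i" for i
    using roots forest_maps_parent_in(1)[OF assms(1)] forest by (auto simp: roots_def)
  have "reaches_root f v" using forest by (simp add: forest_maps_def forest_map_def)
  then show "f v = g v"
  proof (induction rule: reaches_root.induct)
    case (root i)
    then show ?case using fixed_iff by metis
  next
    case (step i)
    show ?case
    proof (cases "f i = i")
      case False
      have "f (f i) \<noteq> i"
        using False forest(1) forest_map_no_two_cycle[of f i] by (auto simp: forest_maps_def)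
      moreover have "{i, f i} \<in> parent_edges g"
        using False by (simp add: edges[symmetric] parent_edges_iff)
      ultimately show ?thesis using step.IH by (auto simp: parent_edges_iff)
    qed (use fixed_iff in metis)
  qed
qed

lemma connected_graph_closer_neighbour:
  fixes V :: "'v set"
  assumes "connected_graph V F" and "r \<in> V"
  shows "\<exists>d :: 'v \<Rightarrow> nat. \<forall>v\<in>V - {r}. \<exists>w. {v, w} \<in> F \<and> d w < d v"
proof -
  let ?R = "{(x, y). {x, y} \<in> F}"
  define d where "d v = (LEAST k. (v, r) \<in> ?R ^^ k)" for v
  have "\<exists>w. {v, w} \<in> F \<and> d w < d v" if "v \<in> V" "v \<noteq> r" for v
  proof -
    have "\<exists>k. (v, r) \<in> ?R ^^ k"
      using assms that(1) by (simp add: connected_graph_def rtrancl_power)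
    then have walk: "(v, r) \<in> ?R ^^ d v" unfolding d_def by (rule LeastI_ex)
    with \<open>v \<noteq> r\<close> obtain k where dist_Suc: "d v = Suc k" by (cases "d v") auto
    with walk obtain w where first_step: "(v, w) \<in> ?R" "(w, r) \<in> ?R ^^ k"
      by (metis relpow_Suc_E2)
    have "d w \<le> k" unfolding d_def using first_step(2) by (rule Least_le)
    with first_step(1) dist_Suc show ?thesis by auto
  qed
  then show ?thesis by blast
qed

lemma connected_graph_arborescence:
  fixes V :: "'v set"
  assumes "connected_graph V F" and "r \<in> V"
  shows "\<exists>f. (f, r) \<in> arborescences V F"
proof -
  obtain d :: "'v \<Rightarrow> nat" where "\<forall>v\<in>V - {r}. \<exists>w. {v, w} \<in> F \<and> d w < d v"
    using connected_graph_closer_neighbour[OF assms] by blast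
  from bchoice[OF this] obtain g
    where closer: "\<And>v. v \<in> V - {r} \<Longrightarrow> {v, g v} \<in> F \<and> d (g v) < d v"
    by blast
  define f where "f v = (if v \<in> V - {r} then g v else v)" for v
  have "forest_map f"
    using closer by (intro forest_map_if_descending[of f d]) (simp add: f_def split: if_splits)
  moreover have "parent_edges f \<subseteq> F" using closer by (auto simp: parent_edges_subset_iff f_def)
  moreover have "f v \<noteq> v" if "v \<in> V - {r}" for v
    using closer[OF that] that by (auto simp: f_def)
  then have "roots V f = {r}" using \<open>r \<in> V\<close> by (auto simp: roots_def f_def)
  ultimately show ?thesis by (auto simp: arborescences_def forest_maps_def)
qed

lemma spanning_tree_eq_parent_edges:
  fixes V :: "'v set"
  assumes "simple_graph V E" and tree: "F \<in> spanning_trees V E" and "r \<in> V"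
  obtains f where "(f, r) \<in> arborescences V E" and "parent_edges f = F"
proof -
  have "F \<subseteq> E" and connected: "connected_graph V F" and acyclic: "\<nexists>c. is_cycle F c"
    using tree by (auto simp: spanning_trees_def is_tree_def)
  then have simple: "simple_graph V F" using assms(1) by (auto simp: simple_graph_def)
  obtain f where arborescence: "(f, r) \<in> arborescences V F"
    using connected_graph_arborescence[OF connected \<open>r \<in> V\<close>] by blast
  then have "parent_edges f \<subseteq> F" by (simp add: arborescences_def forest_maps_def)
  moreover have "connected_graph V (parent_edges f)"
    using is_tree_arborescence[OF simple arborescence] by (simp add: is_tree_def)
  ultimately have "parent_edges f = F"
    by (rule acyclic_eq_connected_subgraph[OF simple acyclic])
  with arborescence \<open>F \<subseteq> E\<close> have "(f, r) \<in> arborescences V E"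
    by (auto simp: arborescences_def forest_maps_def)
  then show thesis using \<open>parent_edges f = F\<close> by (rule that)
qed

theorem bij_betw_arborescences_rooted_spanning_trees:
  assumes "simple_graph V E"
  shows "bij_betw (\<lambda>(f, r). (parent_edges f, r)) (arborescences V E) (rooted_spanning_trees V E)"
proof (rule bij_betw_imageI)
  show "inj_on (\<lambda>(f, r). (parent_edges f, r)) (arborescences V E)"
    using arborescence_unique[OF assms] by (auto simp: inj_on_def)
  show "(\<lambda>(f, r). (parent_edges f, r)) ` arborescences V E = rooted_spanning_trees V E"
  proof (intro equalityI subsetI)
    fix T assume "T \<in> (\<lambda>(f, r). (parent_edges f, r)) ` arborescences V E"
    then obtain f r where "(f, r) \<in> arborescences V E" "T = (parent_edges f, r)" by auto
    then show "T \<in> rooted_spanning_trees V E"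
      using is_tree_arborescence[OF assms]
      by (auto simp: rooted_spanning_trees_def spanning_trees_def arborescences_def
          forest_maps_def roots_def)
  next
    fix T assume "T \<in> rooted_spanning_trees V E"
    then obtain F r where T: "T = (F, r)" "F \<in> spanning_trees V E" "r \<in> V"
      by (auto simp: rooted_spanning_trees_def)
    obtain f where "(f, r) \<in> arborescences V E" "parent_edges f = F"
      using spanning_tree_eq_parent_edges[OF assms T(2,3)] .
    with T(1) show "T \<in> (\<lambda>(f, r). (parent_edges f, r)) ` arborescences V E" by force
  qed
qed

corollary card_rooted_spanning_trees:
  assumes "simple_graph V E"
  shows "card (rooted_spanning_trees V E) = card {f \<in> forest_maps E. card (roots V f) = 1}"
proof -
  have "card (rooted_spanning_trees V E) = card (arborescences V E)"
    using bij_betw_same_card[OF bij_betw_arborescences_rooted_spanning_trees[OF assms]] by simp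
  also have "\<dots> = card (fst ` arborescences V E)"
    by (intro card_image[symmetric]) (auto simp: inj_on_def arborescences_def)
  also have "fst ` arborescences V E = {f \<in> forest_maps E. card (roots V f) = 1}"
    by (force simp: arborescences_def card_1_singleton_iff image_iff)
  finally show ?thesis .
qed

section \<open>The forest polynomial of a graph\<close>

lemma det_graph_laplacian:
  fixes V :: "'v::finite set" and t u :: "'a::comm_ring_1"
  assumes "simple_graph V E"
  shows "det (diagonal_matrix (\<lambda>i. if i \<in> V then t else u)
      + laplacian_matrix (\<lambda>i j. of_bool ({i, j} \<in> E)))
    = u ^ card (- V) * (\<Sum>f\<in>forest_maps E. t ^ card (roots V f))"
proof -
  let ?s = "\<lambda>i. if i \<in> V then t else u" and ?w = "\<lambda>i j. of_bool ({i, j} \<in> E)"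
  have weight_prod: "(\<Prod>i\<in>UNIV. if f i = i then ?s i else ?w i (f i))
      = (if parent_edges f \<subseteq> E then u ^ card (- V) * t ^ card (roots V f) else 0)"
    if "forest_map f" for f
  proof (cases "parent_edges f \<subseteq> E")
    case True
    with that have "f \<in> forest_maps E" by (simp add: forest_maps_def)
    then have "(if f i = i then ?s i else ?w i (f i))
        = (if i \<in> - V then u else 1) * (if i \<in> roots V f then t else 1)" for i
      using forest_maps_parent_in[OF assms] by (auto simp: roots_def)
    then have "(\<Prod>i\<in>UNIV. if f i = i then ?s i else ?w i (f i))
        = (\<Prod>i\<in>UNIV. (if i \<in> - V then u else 1) * (if i \<in> roots V f then t else 1))"
      by simp
    with True show ?thesis by (simp add: prod.distrib prod.If_cases Compl_eq)
  next
    case False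
    then obtain i where "f i \<noteq> i" "{i, f i} \<notin> E" by (auto simp: parent_edges_subset_iff)
    then have "\<exists>i\<in>UNIV. (if f i = i then ?s i else ?w i (f i)) = 0" by (intro bexI[of _ i]) auto
    with False show ?thesis by (simp add: prod_zero)
  qed
  have "det (diagonal_matrix ?s + laplacian_matrix ?w)
      = (\<Sum>f | forest_map f.
          if parent_edges f \<subseteq> E then u ^ card (- V) * t ^ card (roots V f) else 0)"
    unfolding weighted_matrix_forest by (rule sum.cong) (simp_all add: weight_prod)
  also have "\<dots> = (\<Sum>f\<in>forest_maps E. u ^ card (- V) * t ^ card (roots V f))"
    by (simp add: forest_maps_def flip: sum.inter_filter)
  finally show ?thesis by (simp add: sum_distrib_left)
qed

definition forest_polynomial :: "'v::finite set \<Rightarrow> 'v set set \<Rightarrow> int poly" where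
  "forest_polynomial V E = (\<Sum>f\<in>forest_maps E. [:0, 1:] ^ card (roots V f))"

lemma coeff_forest_polynomial:
  "coeff (forest_polynomial V E) n = int (card {f \<in> forest_maps E. card (roots V f) = n})"
proof -
  have "[:0, 1:] ^ j = monom (1 :: int) j" for j by (simp add: monom_altdef)
  then have "coeff (forest_polynomial V E) n
      = (\<Sum>f\<in>forest_maps E. if card (roots V f) = n then 1 else 0)"
    by (simp add: forest_polynomial_def coeff_sum)
  then show ?thesis by (simp flip: sum.inter_filter)
qed

lemma coeff_0_forest_polynomial:
  assumes "simple_graph V E" and "V \<noteq> {}"
  shows "coeff (forest_polynomial V E) 0 = 0"
  using forest_maps_connected_to_root[OF assms(1)] assms(2)
  by (fastforce simp: coeff_forest_polynomial)

lemma coeff_1_forest_polynomial: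
  assumes "simple_graph V E"
  shows "coeff (forest_polynomial V E) 1 = int (card (rooted_spanning_trees V E))"
  by (simp add: coeff_forest_polynomial card_rooted_spanning_trees[OF assms])

section \<open>Configurations\<close>

definition two_step_walks ::
  "'v set \<Rightarrow> 'v set \<Rightarrow> ('v \<Rightarrow> 'v \<Rightarrow> bool) \<Rightarrow> 'v \<Rightarrow> ('v \<times> 'v) set" where
  "two_step_walks P L I p = {(l, q). l \<in> L \<and> q \<in> P \<and> I p l \<and> I q l}"

definition collinearity_edges :: "'v set \<Rightarrow> 'v set \<Rightarrow> ('v \<Rightarrow> 'v \<Rightarrow> bool) \<Rightarrow> 'v set set" where
  "collinearity_edges P L I =
    {{p, q} | p q. p \<in> P \<and> q \<in> P \<and> p \<noteq> q \<and> (\<exists>l\<in>L. I p l \<and> I q l)}"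

lemma collinearity_edges_iff:
  "{p, q} \<in> collinearity_edges P L I
    \<longleftrightarrow> p \<in> P \<and> q \<in> P \<and> p \<noteq> q \<and> (\<exists>l\<in>L. I p l \<and> I q l)"
  by (auto simp: collinearity_edges_def doubleton_eq_iff)

lemma simple_graph_collinearity_edges: "simple_graph P (collinearity_edges P L I)"
  by (auto simp: simple_graph_def collinearity_edges_def)

definition incidence_matrix ::
  "'v set \<Rightarrow> 'v set \<Rightarrow> ('v \<Rightarrow> 'v \<Rightarrow> bool) \<Rightarrow> 'a::comm_ring_1 ^ 'v ^ 'v::finite" where
  "incidence_matrix P L I = (\<chi> p l. of_bool (p \<in> P \<and> l \<in> L \<and> I p l))"

lemma transpose_incidence_matrix:
  "transpose (incidence_matrix P L I) = incidence_matrix L P (\<lambda>l p. I p l)"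
  by (auto simp: incidence_matrix_def transpose_def vec_eq_iff)

lemma incidence_matrix_mult_transpose_nth:
  "(incidence_matrix P L I ** transpose (incidence_matrix P L I)) $ p $ q
    = (if p \<in> P \<and> q \<in> P then of_nat (card {l \<in> L. I p l \<and> I q l}) else 0)"
  by (auto simp: matrix_matrix_mult_def transpose_def incidence_matrix_def Int_def
      simp flip: of_bool_conj intro!: arg_cong[of _ _ "\<lambda>S. of_nat (card S)"])

text \<open>Points and lines share a type only so that the incidence matrix is square; the two sets
  need not be disjoint.\<close>

locale configuration =
  fixes P L :: "'v::finite set" and I :: "'v \<Rightarrow> 'v \<Rightarrow> bool" and r s :: nat
  assumes points_nonempty: "P \<noteq> {}" and lines_nonempty: "L \<noteq> {}"
    and card_lines_through: "p \<in> P \<Longrightarrow> card {l \<in> L. I p l} = r"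
    and card_points_on: "l \<in> L \<Longrightarrow> card {p \<in> P. I p l} = s"
    and common_line_unique: "\<lbrakk>p \<in> P; q \<in> P; p \<noteq> q; l \<in> L; l' \<in> L; I p l; I q l; I p l'; I q l'\<rbrakk>
      \<Longrightarrow> l = l'"
begin

lemma dual: "configuration L P (\<lambda>l p. I p l) s r"
  by unfold_locales
    (use points_nonempty lines_nonempty card_lines_through card_points_on common_line_unique
      in blast)+

lemma card_common_lines:
  assumes "p \<in> P" and "q \<in> P" and "p \<noteq> q"
  shows "card {l \<in> L. I p l \<and> I q l} = of_bool ({p, q} \<in> collinearity_edges P L I)"
proof (cases "\<exists>l\<in>L. I p l \<and> I q l")
  case True
  then obtain l where "l \<in> L" "I p l" "I q l" by blast
  then have "{l \<in> L. I p l \<and> I q l} = {l}" using common_line_unique[OF assms] by auto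
  with True assms show ?thesis by (simp add: collinearity_edges_iff)
next
  case False
  then have "{l \<in> L. I p l \<and> I q l} = {}" by blast
  with False show ?thesis by (simp only: collinearity_edges_iff) simp
qed

lemma card_two_step_walks:
  assumes "p \<in> P"
  shows "card (two_step_walks P L I p) = r * s"
proof -
  have "two_step_walks P L I p = (SIGMA l:{l \<in> L. I p l}. {q \<in> P. I q l})"
    by (auto simp: two_step_walks_def)
  then show ?thesis using assms by (simp add: card_points_on card_lines_through)
qed

lemma sum_card_common_lines:
  assumes "p \<in> P"
  shows "(\<Sum>q\<in>P. card {l \<in> L. I p l \<and> I q l}) = r * s"
proof -
  have "two_step_walks P L I p = prod.swap ` (SIGMA q:P. {l \<in> L. I p l \<and> I q l})"
    by (auto simp: two_step_walks_def)
  then show ?thesis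
    using card_two_step_walks[OF assms] by (simp add: card_image)
qed

lemma collinearity_degree:
  assumes "p \<in> P"
  shows "r + card {q. {p, q} \<in> collinearity_edges P L I} = r * s"
proof -
  have "{q. {p, q} \<in> collinearity_edges P L I}
      = (P - {p}) \<inter> {q. {p, q} \<in> collinearity_edges P L I}"
    by (auto simp: collinearity_edges_iff)
  then have "card {q. {p, q} \<in> collinearity_edges P L I}
      = (\<Sum>q\<in>P - {p}. of_bool ({p, q} \<in> collinearity_edges P L I))"
    by simp
  also have "\<dots> = (\<Sum>q\<in>P - {p}. card {l \<in> L. I p l \<and> I q l})"
    using assms by (intro sum.cong refl card_common_lines[symmetric]) auto
  finally show ?thesis
    using sum_card_common_lines[OF assms] assms by (simp add: sum.remove[of P p] card_lines_through)
qed

lemma diff_incidence_matrix_mult_transpose: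
  fixes t :: "'a::comm_ring_1"
  defines "N \<equiv> incidence_matrix P L I"
  shows "mat (t + of_nat (r * s)) - N ** transpose N
    = diagonal_matrix (\<lambda>i. if i \<in> P then t else t + of_nat (r * s))
      + laplacian_matrix (\<lambda>i j. of_bool ({i, j} \<in> collinearity_edges P L I))"
proof -
  let ?E = "collinearity_edges P L I"
  have degree: "(\<Sum>q\<in>UNIV - {p}. of_bool ({p, q} \<in> ?E))
      = (if p \<in> P then of_nat (r * s) - of_nat r else 0 :: 'a)" for p
  proof (cases "p \<in> P")
    case True
    have "(\<Sum>q\<in>UNIV - {p}. of_bool ({p, q} \<in> ?E)) = (of_nat (card {q. {p, q} \<in> ?E}) :: 'a)"
      by (auto simp: collinearity_edges_iff intro!: arg_cong[of _ _ "\<lambda>S. of_nat (card S)"])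
    also have "\<dots> = of_nat (r * s) - of_nat r"
      by (simp only: collinearity_degree[OF True, symmetric] of_nat_add add_diff_cancel_left')
    finally show ?thesis using True by simp
  qed (simp add: collinearity_edges_iff)
  have "(N ** transpose N) $ p $ q = of_bool ({p, q} \<in> ?E)" if "p \<noteq> q" for p q
    using that by (cases "p \<in> P \<and> q \<in> P")
      (auto simp: N_def incidence_matrix_mult_transpose_nth card_common_lines
        collinearity_edges_iff)
  moreover have "(N ** transpose N) $ p $ p = (if p \<in> P then of_nat r else 0)" for p
    by (simp add: N_def incidence_matrix_mult_transpose_nth card_lines_through)
  ultimately show ?thesis
    by (simp add: vec_eq_iff mat_def diagonal_matrix_def laplacian_matrix_def degree
        del: sum_of_bool_eq)
qed

lemma det_diff_incidence_matrix_mult_transpose: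
  defines "x \<equiv> [:int (r * s), 1:]" and "N \<equiv> incidence_matrix P L I"
  shows "det (mat x - N ** transpose N)
    = x ^ card (- P) * forest_polynomial P (collinearity_edges P L I)"
proof -
  have "x = [:0, 1:] + of_nat (r * s)" by (simp add: x_def of_nat_poly)
  then show ?thesis
    unfolding N_def forest_polynomial_def
    by (simp only: diff_incidence_matrix_mult_transpose
        det_graph_laplacian[OF simple_graph_collinearity_edges])
qed

lemma forest_polynomial_dual:
  defines "x \<equiv> [:int (r * s), 1:]"
  shows "x ^ card L * forest_polynomial P (collinearity_edges P L I)
    = x ^ card P * forest_polynomial L (collinearity_edges L P (\<lambda>l p. I p l))"
    (is "_ * ?F = _ * ?G")
proof -
  interpret dual: configuration L P "\<lambda>l p. I p l" s r by (rule dual)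
  let ?N = "incidence_matrix P L I :: int poly ^ 'v ^ 'v"
  have "x ^ card (- P) * ?F = det (mat x - ?N ** transpose ?N)"
    unfolding x_def by (rule det_diff_incidence_matrix_mult_transpose[symmetric])
  also have "\<dots> = det (mat x - transpose ?N ** ?N)"
    by (rule det_diff_mult_commute)
  also have "\<dots> = x ^ card (- L) * ?G"
    using dual.det_diff_incidence_matrix_mult_transpose
    by (simp add: x_def transpose_incidence_matrix mult.commute)
  finally have "x ^ (card P + card (- P)) * (x ^ card L * ?F)
      = x ^ (card L + card (- L)) * (x ^ card P * ?G)"
    by (simp add: power_add mult_ac)
  moreover have "card S + card (- S) = CARD('v)" for S :: "'v set"
    using card_Un_disjoint[of S "- S"] by (simp add: Compl_partition)
  ultimately show ?thesis by (simp add: x_def)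
qed

lemma card_rooted_spanning_trees_dual:
  "card (rooted_spanning_trees P (collinearity_edges P L I)) * (r * s) ^ card L
    = card (rooted_spanning_trees L (collinearity_edges L P (\<lambda>l p. I p l))) * (r * s) ^ card P"
proof -
  have coeff_1: "coeff ([:int (r * s), 1:] ^ n * forest_polynomial V E) 1
      = int (card (rooted_spanning_trees V E) * (r * s) ^ n)"
    if "simple_graph V E" "V \<noteq> {}" for n and V :: "'v set" and E
    by (simp add: coeff_mult coeff_0_power coeff_0_forest_polynomial[OF that]
        coeff_1_forest_polynomial[OF that(1), simplified])
  from arg_cong[OF forest_polynomial_dual, of "\<lambda>p. coeff p 1"] show ?thesis
    by (simp only: coeff_1[OF simple_graph_collinearity_edges points_nonempty]
        coeff_1[OF simple_graph_collinearity_edges lines_nonempty] of_nat_eq_iff)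
qed

theorem rooted_spanning_trees_dual:
  "rooted_spanning_trees P (collinearity_edges P L I)
      \<times> (\<Pi>\<^sub>E l\<in>L. two_step_walks L P (\<lambda>l p. I p l) l)
    \<approx> rooted_spanning_trees L (collinearity_edges L P (\<lambda>l p. I p l))
      \<times> (\<Pi>\<^sub>E p\<in>P. two_step_walks P L I p)"
proof -
  interpret dual: configuration L P "\<lambda>l p. I p l" s r by (rule dual)
  have "card (\<Pi>\<^sub>E l\<in>L. two_step_walks L P (\<lambda>l p. I p l) l) = (r * s) ^ card L"
    by (simp add: card_PiE dual.card_two_step_walks mult.commute)
  moreover have "card (\<Pi>\<^sub>E p\<in>P. two_step_walks P L I p) = (r * s) ^ card P"
    by (simp add: card_PiE card_two_step_walks)
  ultimately show ?thesis
    by (subst eqpoll_iff_card)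
       (auto simp: card_cartesian_product card_rooted_spanning_trees_dual
         intro!: finite_cartesian_product finite_PiE)
qed

end

section \<open>Subspaces of a finite vector space\<close>

lemma Bq_eqI: "\<lbrakk>X \<in> Bq k; Y \<in> Bq k; X \<subseteq> Y\<rbrakk> \<Longrightarrow> X = Y"
  using vec.subspace_dim_equal[of X Y] by (simp add: Bq_def)

lemma Bq_nonempty:
  assumes "k \<le> CARD('n)"
  shows "Bq k \<noteq> ({} :: ('a::{field,finite} ^ 'n::finite) set set)"
proof -
  have "k \<le> vec.dim (UNIV :: ('a ^ 'n) set)" using assms by (simp add: card_cart_basis)
  from vec.choose_subspace_of_subspace[OF this] show ?thesis by (auto simp: Bq_def)
qed

lemma dim_Int_less_iff:
  assumes "X \<in> Bq k" and "Y \<in> Bq k"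
  shows "vec.dim (X \<inter> Y) < k \<longleftrightarrow> X \<noteq> Y"
proof
  assume "X \<noteq> Y"
  have "vec.dim (X \<inter> Y) \<noteq> k"
  proof
    assume "vec.dim (X \<inter> Y) = k"
    then have "X \<inter> Y \<in> Bq k"
      using assms by (simp add: Bq_def vec.subspace_inter)
    then have "X \<inter> Y = X" and "X \<inter> Y = Y" using assms Bq_eqI by blast+
    with \<open>X \<noteq> Y\<close> show False by simp
  qed
  moreover have "vec.dim (X \<inter> Y) \<le> k"
    using assms(1) vec.dim_subset[of "X \<inter> Y" X] by (simp add: Bq_def)
  ultimately show "vec.dim (X \<inter> Y) < k" by simp
qed (use assms in \<open>auto simp: Bq_def\<close>)

lemma common_hyperplane_eq_Int:
  assumes "X \<in> Bq (Suc k)" and "Y \<in> Bq (Suc k)" and "X \<noteq> Y"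
    and "A \<in> Bq k" and "A \<subseteq> X" and "A \<subseteq> Y"
  shows "A = X \<inter> Y"
proof (rule vec.subspace_dim_equal)
  show "vec.dim A \<ge> vec.dim (X \<inter> Y)"
    using dim_Int_less_iff[OF assms(1,2)] assms(3,4) by (simp add: Bq_def)
qed (use assms in \<open>auto simp: Bq_def intro: vec.subspace_inter\<close>)

lemma dim_Int_eq_iff_common_hyperplane:
  assumes "X \<in> Bq (Suc k)" and "Y \<in> Bq (Suc k)"
  shows "vec.dim (X \<inter> Y) = k \<longleftrightarrow> X \<noteq> Y \<and> (\<exists>A\<in>Bq k. A \<subseteq> X \<and> A \<subseteq> Y)"
proof
  assume dim_Int: "vec.dim (X \<inter> Y) = k"
  then have "X \<inter> Y \<in> Bq k" using assms by (simp add: Bq_def vec.subspace_inter)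
  then have "\<exists>A\<in>Bq k. A \<subseteq> X \<and> A \<subseteq> Y" by (rule bexI[rotated]) simp
  moreover have "X \<noteq> Y" using dim_Int dim_Int_less_iff[OF assms] by simp
  ultimately show "X \<noteq> Y \<and> (\<exists>A\<in>Bq k. A \<subseteq> X \<and> A \<subseteq> Y)" by simp
next
  assume "X \<noteq> Y \<and> (\<exists>A\<in>Bq k. A \<subseteq> X \<and> A \<subseteq> Y)"
  then obtain A where "X \<noteq> Y" and A: "A \<in> Bq k" "A \<subseteq> X" "A \<subseteq> Y" by blast
  have "A = X \<inter> Y" by (rule common_hyperplane_eq_Int[OF assms \<open>X \<noteq> Y\<close> A])
  with A(1) show "vec.dim (X \<inter> Y) = k" by (simp add: Bq_def)
qed

lemma dim_span_Un_Int:
  fixes A B :: "('a::field ^ 'n::finite) set"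
  assumes "vec.subspace A" and "vec.subspace B"
  shows "vec.dim (vec.span (A \<union> B)) + vec.dim (A \<inter> B) = vec.dim A + vec.dim B"
proof -
  have "vec.span (A \<union> B) = {x + y |x y. x \<in> A \<and> y \<in> B}"
    using assms by (simp only: vec.span_Un vec.span_eq_iff[THEN iffD2])
  with vec.dim_sums_Int[OF assms] show ?thesis by simp
qed

lemma Suc_dim_Int_eq_iff_common_cover:
  assumes "A \<in> Bq k" and "B \<in> Bq k"
  shows "Suc (vec.dim (A \<inter> B)) = k \<longleftrightarrow> A \<noteq> B \<and> (\<exists>X\<in>Bq (Suc k). A \<subseteq> X \<and> B \<subseteq> X)"
proof -
  have dim_span: "vec.dim (vec.span (A \<union> B)) + vec.dim (A \<inter> B) = k + k"
    using dim_span_Un_Int[of A B] assms by (simp add: Bq_def)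
  show ?thesis
  proof
    assume dim_Int: "Suc (vec.dim (A \<inter> B)) = k"
    with dim_span have "vec.dim (vec.span (A \<union> B)) = Suc k" by linarith
    then have "vec.span (A \<union> B) \<in> Bq (Suc k)" by (simp add: Bq_def)
    then have "\<exists>X\<in>Bq (Suc k). A \<subseteq> X \<and> B \<subseteq> X"
      by (rule bexI[rotated]) (use vec.span_superset[of "A \<union> B"] in simp)
    moreover have "A \<noteq> B" using dim_Int dim_Int_less_iff[OF assms] by linarith
    ultimately show "A \<noteq> B \<and> (\<exists>X\<in>Bq (Suc k). A \<subseteq> X \<and> B \<subseteq> X)" by simp
  next
    assume "A \<noteq> B \<and> (\<exists>X\<in>Bq (Suc k). A \<subseteq> X \<and> B \<subseteq> X)"
    then obtain X where "A \<noteq> B" and X: "X \<in> Bq (Suc k)" "A \<subseteq> X" "B \<subseteq> X" by blast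
    have "vec.dim (vec.span (A \<union> B)) \<le> Suc k"
      using X vec.dim_subset[of "A \<union> B" X] by (simp add: Bq_def)
    moreover have "vec.dim (A \<inter> B) < k" using \<open>A \<noteq> B\<close> dim_Int_less_iff[OF assms] by simp
    ultimately show "Suc (vec.dim (A \<inter> B)) = k" using dim_span by linarith
  qed
qed

lemma grassmann_edges_Suc_eq_collinearity_edges:
  "grassmann_edges (Suc k) = collinearity_edges (Bq (Suc k)) (Bq k) (\<lambda>X A. A \<subseteq> X)"
  unfolding grassmann_edges_def collinearity_edges_def Suc_eq_plus1[symmetric] nat.inject
  by (intro Collect_cong ex_cong1 conj_cong refl dim_Int_eq_iff_common_hyperplane)

lemma grassmann_edges_eq_collinearity_edges:
  "grassmann_edges k = collinearity_edges (Bq k) (Bq (Suc k)) (\<lambda>A X. A \<subseteq> X)"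
  unfolding grassmann_edges_def collinearity_edges_def Suc_eq_plus1[symmetric]
  by (intro Collect_cong ex_cong1 conj_cong refl Suc_dim_Int_eq_iff_common_cover)

lemma linear_automorphism_between_subspaces:
  fixes X Y :: "('a::field ^ 'n::finite) set"
  assumes "vec.subspace X" and "vec.subspace Y" and "vec.dim X = vec.dim Y"
  shows "\<exists>g. Vector_Spaces.linear (*s) (*s) g \<and> inj g \<and> g ` X = Y"
proof -
  obtain B where basis_X: "finite B" "vec.independent B" "vec.span B = X" "card B = vec.dim X"
    using vec.basis_subspace_exists[OF assms(1)] by metis
  obtain C where basis_Y: "finite C" "vec.independent C" "vec.span C = Y" "card C = vec.dim Y"
    using vec.basis_subspace_exists[OF assms(2)] by metis
  obtain h where bij_h: "bij_betw h B C"
    using finite_same_card_bij[of B C] basis_X basis_Y assms(3) by auto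
  then obtain g where extends_h: "Vector_Spaces.linear (*s) (*s) g" "inj g" "\<forall>x\<in>B. g x = h x"
    using vec.linear_independent_extend_inj[of B h] basis_X(2) basis_Y(2)
    by (auto simp: bij_betw_def)
  then have "g ` B = C" using bij_h by (auto simp: bij_betw_def image_iff)
  then have "g ` X = Y"
    using vec.linear_span_image[OF extends_h(1), of B] basis_X(3) basis_Y(3) by simp
  with extends_h show ?thesis by blast
qed

lemma image_in_Bq:
  assumes "Vector_Spaces.linear (*s) (*s) g" and "inj g" and "X \<in> Bq k"
  shows "g ` X \<in> Bq k"
proof -
  have "vec.dim (g ` X) = vec.dim X"
    by (rule vec.dim_image_eq[OF assms(1) inj_on_subset[OF assms(2)]]) simp
  moreover have "vec.subspace (g ` X)"
    using assms(3) by (intro vec.linear_subspace_image[OF assms(1)]) (simp add: Bq_def)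
  ultimately show ?thesis using assms(3) by (simp add: Bq_def)
qed

lemma card_related_subspaces_le:
  fixes X Y :: "('a::{field,finite} ^ 'n::finite) set"
  assumes "X \<in> Bq m" and "Y \<in> Bq m"
    and invariant: "\<And>g A B. inj g \<Longrightarrow> R (g ` A) (g ` B) \<longleftrightarrow> R A B"
  shows "card {A \<in> Bq k. R X A} \<le> card {A \<in> Bq k. R Y A}"
proof -
  obtain g where automorphism: "Vector_Spaces.linear (*s) (*s) g" "inj g" "g ` X = Y"
    using linear_automorphism_between_subspaces[of X Y] assms(1,2) by (auto simp: Bq_def)
  have "inj_on ((`) g) {A \<in> Bq k. R X A}"
    using automorphism(2) by (simp add: inj_on_def inj_image_eq_iff)
  moreover have "(`) g ` {A \<in> Bq k. R X A} \<subseteq> {A \<in> Bq k. R Y A}"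
    using automorphism invariant[OF automorphism(2), of X] by (auto simp: image_in_Bq)
  ultimately show ?thesis by (rule card_inj_on_le) simp
qed

lemma card_related_subspaces_eq:
  fixes X Y :: "('a::{field,finite} ^ 'n::finite) set"
  assumes "X \<in> Bq m" and "Y \<in> Bq m"
    and "\<And>g A B. inj g \<Longrightarrow> R (g ` A) (g ` B) \<longleftrightarrow> R A B"
  shows "card {A \<in> Bq k. R X A} = card {A \<in> Bq k. R Y A}"
  using card_related_subspaces_le[where R = R, OF assms]
    card_related_subspaces_le[where R = R, OF assms(2,1,3)]
  by (rule antisym)

lemma configuration_Bq:
  assumes "Suc k \<le> CARD('n)"
  shows "\<exists>r s. configuration (Bq (Suc k) :: ('a::{field,finite} ^ 'n::finite) set set) (Bq k)
    (\<lambda>X A. A \<subseteq> X) r s"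
proof -
  let ?P = "Bq (Suc k) :: ('a ^ 'n) set set" and ?L = "Bq k :: ('a ^ 'n) set set"
  have nonempty: "?P \<noteq> {}" "?L \<noteq> {}" using assms by (simp_all add: Bq_nonempty)
  then obtain X\<^sub>0 A\<^sub>0 where X\<^sub>0: "X\<^sub>0 \<in> ?P" and A\<^sub>0: "A\<^sub>0 \<in> ?L" by blast
  have "configuration ?P ?L (\<lambda>X A. A \<subseteq> X) (card {A \<in> ?L. A \<subseteq> X\<^sub>0}) (card {X \<in> ?P. A\<^sub>0 \<subseteq> X})"
  proof
    show "card {A \<in> ?L. A \<subseteq> X} = card {A \<in> ?L. A \<subseteq> X\<^sub>0}" if "X \<in> ?P" for X
      by (rule card_related_subspaces_eq[where R = "\<lambda>X A. A \<subseteq> X", OF that X\<^sub>0])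
        (rule inj_image_subset_iff)
    show "card {X \<in> ?P. A \<subseteq> X} = card {X \<in> ?P. A\<^sub>0 \<subseteq> X}" if "A \<in> ?L" for A
      by (rule card_related_subspaces_eq[where R = "(\<subseteq>)", OF that A\<^sub>0])
        (rule inj_image_subset_iff)
    show "A = B" if "X \<in> ?P" "Y \<in> ?P" "X \<noteq> Y" "A \<in> ?L" "B \<in> ?L" "A \<subseteq> X" "A \<subseteq> Y" "B \<subseteq> X" "B \<subseteq> Y"
      for X Y A B
      using common_hyperplane_eq_Int[OF that(1-4,6,7)] common_hyperplane_eq_Int[OF that(1-3,5,8,9)]
      by simp
  qed (fact nonempty)+
  then show ?thesis by blast
qed

lemma UD_Suc_eq_two_step_walks: "UD (Suc k) = two_step_walks (Bq (Suc k)) (Bq k) (\<lambda>X A. A \<subseteq> X)"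
  by (auto simp: UD_def two_step_walks_def fun_eq_iff)

lemma DU_Suc_eq_two_step_walks: "DU (Suc k) = two_step_walks (Bq k) (Bq (Suc k)) (\<lambda>A X. A \<subseteq> X)"
  by (auto simp: DU_def two_step_walks_def fun_eq_iff)

theorem theorem3p3:
  fixes m :: nat
  assumes "1 \<le> m" and "2 * m \<le> CARD('n::finite)"
  shows "(Tq m :: (('a::{field,finite} ^ 'n) set set set \<times> ('a ^ 'n) set) set)
           \<times> (\<Pi>\<^sub>E X \<in> (Bq (m - 1) :: ('a ^ 'n) set set). DU m X)
         \<approx> (Tq (m - 1) :: (('a ^ 'n) set set set \<times> ('a ^ 'n) set) set)
           \<times> (\<Pi>\<^sub>E X \<in> (Bq m :: ('a ^ 'n) set set). UD m X)"
proof -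
  obtain k where m_eq: "m = Suc k" using assms(1) by (cases m) auto
  let ?P = "Bq m :: ('a ^ 'n) set set" and ?L = "Bq k :: ('a ^ 'n) set set"
  obtain r s where "configuration ?P ?L (\<lambda>X A. A \<subseteq> X) r s"
    using configuration_Bq[of k, where 'a = 'a and 'n = 'n] assms(2) m_eq by auto
  then interpret configuration ?P ?L "\<lambda>X A. A \<subseteq> X" r s .
  have "Tq m = rooted_spanning_trees ?P (collinearity_edges ?P ?L (\<lambda>X A. A \<subseteq> X))"
    by (simp add: Tq_def m_eq grassmann_edges_Suc_eq_collinearity_edges)
  moreover have "Tq k = rooted_spanning_trees ?L (collinearity_edges ?L ?P (\<lambda>A X. A \<subseteq> X))"
    by (simp add: Tq_def m_eq grassmann_edges_eq_collinearity_edges)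
  ultimately show ?thesis
    using rooted_spanning_trees_dual
    by (simp add: m_eq UD_Suc_eq_two_step_walks DU_Suc_eq_two_step_walks)
qed

end
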